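(* Let $\alpha\in(0,1)$, let $\Theta_0\subseteq\Theta$, and consider testing $\mathrm H_0:\theta\in\Theta_0$ against $\mathrm H_1:\theta\in\Theta\setminus\Theta_0$. The split composite likelihood ratio test (reject $\mathrm H_0$ if $V^0_{\boldsymbol\alpha,\boldsymbol\beta,n}>1/\alpha$) and the swapped composite likelihood ratio test (reject $\mathrm H_0$ if $\bar V_{\boldsymbol\alpha,\boldsymbol\beta,n}>1/\alpha$) control the Type I error at level $\alpha$ for all $n\in\mathbb N$; that is, for every $n\in\mathbb N$, $$\sup_{\theta^*\in\Theta_0}\mathrm{Pr}_{\theta^*}\big(V^0_{\boldsymbol\alpha,\boldsymbol\beta,n}>1/\alpha\big)\le\alpha\quad\text{and}\quad \sup_{\theta^*\in\Theta_0}\mathrm{Pr}_{\theta^*}\big(\bar V_{\boldsymbol\alpha,\boldsymbol\beta,n}>1/\alpha\big)\le\alpha .$$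
   Context: Model. $d,q\in\mathbb N$, $\mathbb X\subseteq\mathbb R^d$, $\Theta\subseteq\mathbb R^q$. $\{\mathcal P_\theta:\theta\in\Theta\}$ is a parametric family of distributions on $\mathbb X$ with probability density or mass functions $p(x;\theta)$ ("PDF" means PDF or PMF throughout). $\mathrm{Pr}_{\theta^*}$ is probability when the data $X_1,\dots,X_{2n}$ are i.i.d. from $\mathcal P_{\theta^*}$, i.e. with PDF $p(x;\theta^* )$. Index sets. $[d]=\{1,\dots,d\}$; $\mathbb S_d$ is the set of all non-empty subsets of $[d]$; $\mathbb T_d$ is the set of all ordered pairs $T=(\overleftarrow T,\overrightarrow T)$ of disjoint non-empty subsets of $[d]$ (their union need not be $[d]$; so $|\mathbb T_d|=3^d-2^{d+1}+1$). For $x\in\mathbb R^d$ and $S\subseteq[d]$, $x_S$ is the subvector of coordinates indexed by $S$. $p(x_S;\theta)$ denotes the marginal PDF of $X_S$ and $p(x_{\overleftarrow T}\mid x_{\overrightarrow T};\theta)$ the conditional PDF of $X_{\overleftarrow T}$ given $X_{\overrightarrow T}=x_{\overrightarrow T}$ when $X\sim\mathcal P_\theta$ (a fixed version, which is a PDF in $x_{\overleftarrow T}$ for each $x_{\overrightarrow T}$). Composite likelihood. Fixed weights $\alpha_S\ge0$ ($S\in\mathbb S_d$), $\beta_T\ge0$ ($T\in\mathbb T_d$), collected in $\boldsymbol\alpha=(\alpha_S)_{S}$, $\boldsymbol\beta=(\beta_T)_{T}$, satisfy $\gamma=\sum_{S\in\mathbb S_d}\alpha_S+\sum_{T\in\mathbb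 T_d}\beta_T>0$. The individual composite likelihood is $$p_{\boldsymbol\alpha,\boldsymbol\beta}(x;\theta)=\prod_{S\in\mathbb S_d}[p(x_S;\theta)]^{\alpha_S/\gamma}\prod_{T\in\mathbb T_d}[p(x_{\overleftarrow T}\mid x_{\overrightarrow T};\theta)]^{\beta_T/\gamma}$$ (with $0^0=1$). The weights are unrelated to the scalar level $\alpha$. Split data and statistics. The sample $X_1,\dots,X_{2n}$ is split into $\mathbf X_n^0=(X_1,\dots,X_n)=(X_1^0,\dots,X_n^0)$ and $\mathbf X_n^1=(X_{n+1},\dots,X_{2n})=(X_1^1,\dots,X_n^1)$. For $k\in\{0,1\}$, $\tilde\theta_n^k$ is an arbitrary $\Theta$-valued estimator (measurable function) of the data $\mathbf X_n^k$ only. Put $L_{\boldsymbol\alpha,\boldsymbol\beta}(\theta;\mathbf X_n^k)=\prod_{i=1}^n p_{\boldsymbol\alpha,\boldsymbol\beta}(X_i^k;\theta)$, and let $$\hat\theta_n^k\in\underset{\theta\in\Theta_0}{\arg\max}\;L_{\boldsymbol\alpha,\boldsymbol\beta}(\theta;\mathbf X_n^k)$$ be the maximum composite likelihood estimator over $\Theta_0$ (assumed to exist and be measurable). The split and swapped test statistics are $$V^k_{\boldsymbol\alpha,\boldsymbol\beta,n}=\frac{L_{\boldsymbol\alpha,\boldsymbol\beta}(\tilde\theta_n^{1-k};\mathbf X_n^k)}{L_{\boldsymbol\alpha,\boldsymbol\beta}(\hat\theta_n^{k};\mathbf X_n^k)}\ (k\in\{0,1\}),\qquad \bar V_{\boldsymbol\alpha,\boldsymbol\beta,n}=\frac{V^0_{\boldsymbol\alpha,\boldsymbol\beta,n}+V^1_{\boldsymbol\alpha,\boldsymbol\beta,n}}{2}.$$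 *)

theory Defs
  imports "HOL-Probability.Probability"
begin

text \<open>The index set \<open>[d]\<close> is a finite type \<open>'d\<close>. A subvector with index set \<open>S\<close> is an
  extensional function on \<open>S\<close>, so that it lives in the space of \<open>\<Pi>\<^sub>M i\<in>S. borel\<close>.\<close>

definition subvec :: "'d set \<Rightarrow> real ^ 'd::finite \<Rightarrow> 'd \<Rightarrow> real" where
  "subvec S x = restrict (\<lambda>i. x $ i) S"

abbreviation subvec_borel :: "'d set \<Rightarrow> ('d::finite \<Rightarrow> real) measure" where
  "subvec_borel S \<equiv> Pi\<^sub>M S (\<lambda>_. borel)"

text \<open>Probability mass functions (\<open>disc\<close>) are densities with respect to counting measure,
  probability density functions are densities with respect to Lebesgue measure. Counting measure
  is taken on the whole (uncountable) space of subvectors, so the distributions of a discrete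
  family need not have a common countable support. Since it is not a measure on the Borel sets,
  \<open>distributed\<close> is not applicable, and the density property is spelled out below.\<close>

definition ref_measure :: "bool \<Rightarrow> 'd set \<Rightarrow> ('d::finite \<Rightarrow> real) measure" where
  "ref_measure disc S =
     (if disc then count_space (S \<rightarrow>\<^sub>E UNIV) else Pi\<^sub>M S (\<lambda>_. lborel))"

definition is_marginal_pdf ::
  "bool \<Rightarrow> (real ^ 'd::finite) measure \<Rightarrow> 'd set \<Rightarrow> (('d \<Rightarrow> real) \<Rightarrow> real) \<Rightarrow> bool" where
  "is_marginal_pdf disc P S f \<longleftrightarrow>
     f \<in> borel_measurable (subvec_borel S) \<and>
     (\<forall>y. 0 \<le> f y) \<and>
     (\<forall>A \<in> sets (subvec_borel S).
        emeasure P {x \<in> space P. subvec S x \<in> A}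
          = (\<integral>\<^sup>+ y\<in>A. ennreal (f y) \<partial>ref_measure disc S))"

text \<open>\<open>f y z\<close> is the conditional density of \<open>X\<^sub>S = y\<close> given \<open>X\<^sub>R = z\<close>: a PDF in \<open>y\<close> for
  each \<open>z\<close>, and the density of a regular conditional distribution of \<open>X\<^sub>S\<close> given \<open>X\<^sub>R\<close>
  under \<open>P\<close>.\<close>

definition is_conditional_pdf ::
  "bool \<Rightarrow> (real ^ 'd::finite) measure \<Rightarrow> 'd set \<Rightarrow> 'd set
     \<Rightarrow> (('d \<Rightarrow> real) \<Rightarrow> ('d \<Rightarrow> real) \<Rightarrow> real) \<Rightarrow> bool" where
  "is_conditional_pdf disc P S R f \<longleftrightarrow>
     (\<lambda>(y, z). f y z) \<in> borel_measurable (subvec_borel S \<Otimes>\<^sub>M subvec_borel R) \<and>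
     (\<forall>y z. 0 \<le> f y z) \<and>
     (\<forall>z \<in> space (subvec_borel R). (\<integral>\<^sup>+ y. ennreal (f y z) \<partial>ref_measure disc S) = 1) \<and>
     (\<forall>A \<in> sets (subvec_borel S). \<forall>B \<in> sets (subvec_borel R).
        emeasure P {x \<in> space P. subvec S x \<in> A \<and> subvec R x \<in> B}
          = (\<integral>\<^sup>+ x\<in>{x \<in> space P. subvec R x \<in> B}.
               (\<integral>\<^sup>+ y\<in>A. ennreal (f y (subvec R x)) \<partial>ref_measure disc S) \<partial>P))"

definition nonempty_subsets :: "'d::finite set set" where
  "nonempty_subsets = {S. S \<noteq> {}}"

definition disjoint_pairs :: "('d::finite set \<times> 'd set) set" where
  "disjoint_pairs = {(S, R). S \<noteq> {} \<and> R \<noteq> {} \<and> S \<inter> R = {}}"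

definition total_weight ::
  "('d::finite set \<Rightarrow> real) \<Rightarrow> ('d set \<times> 'd set \<Rightarrow> real) \<Rightarrow> real" where
  "total_weight a b = (\<Sum>S\<in>nonempty_subsets. a S) + (\<Sum>T\<in>disjoint_pairs. b T)"

text \<open>\<open>powr\<close> has \<open>0 powr 0 = 0\<close>, whereas the convention here is \<open>0\<^sup>0 = 1\<close>.\<close>

definition rpow :: "real \<Rightarrow> real \<Rightarrow> real" where
  "rpow x r = (if r = 0 then 1 else x powr r)"

text \<open>\<open>pm S \<theta> y\<close> stands for \<open>p(x\<^sub>S; \<theta>)\<close> at \<open>x\<^sub>S = y\<close>, and \<open>pc (S, R) \<theta> y z\<close> for
  \<open>p(x\<^sub>S | x\<^sub>R; \<theta>)\<close> at \<open>x\<^sub>S = y\<close>, \<open>x\<^sub>R = z\<close>; \<open>a\<close> and \<open>b\<close> are the weights.\<close>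

definition composite_pdf ::
  "('d::finite set \<Rightarrow> 'p \<Rightarrow> ('d \<Rightarrow> real) \<Rightarrow> real)
   \<Rightarrow> ('d set \<times> 'd set \<Rightarrow> 'p \<Rightarrow> ('d \<Rightarrow> real) \<Rightarrow> ('d \<Rightarrow> real) \<Rightarrow> real)
   \<Rightarrow> ('d set \<Rightarrow> real) \<Rightarrow> ('d set \<times> 'd set \<Rightarrow> real) \<Rightarrow> 'p \<Rightarrow> real ^ 'd \<Rightarrow> real" where
  "composite_pdf pm pc a b \<theta> x =
     (\<Prod>S\<in>nonempty_subsets. rpow (pm S \<theta> (subvec S x)) (a S / total_weight a b)) *
     (\<Prod>T\<in>disjoint_pairs.
        rpow (pc T \<theta> (subvec (fst T) x) (subvec (snd T) x)) (b T / total_weight a b))"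

definition composite_lik ::
  "('d::finite set \<Rightarrow> 'p \<Rightarrow> ('d \<Rightarrow> real) \<Rightarrow> real)
   \<Rightarrow> ('d set \<times> 'd set \<Rightarrow> 'p \<Rightarrow> ('d \<Rightarrow> real) \<Rightarrow> ('d \<Rightarrow> real) \<Rightarrow> real)
   \<Rightarrow> ('d set \<Rightarrow> real) \<Rightarrow> ('d set \<times> 'd set \<Rightarrow> real)
   \<Rightarrow> nat \<Rightarrow> 'p \<Rightarrow> (nat \<Rightarrow> real ^ 'd) \<Rightarrow> real" where
  "composite_lik pm pc a b n \<theta> xs = (\<Prod>i=1..n. composite_pdf pm pc a b \<theta> (xs i))"

definition sample_space :: "(real ^ 'd::finite) set \<Rightarrow> nat \<Rightarrow> (nat \<Rightarrow> real ^ 'd) measure" where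
  "sample_space X m = Pi\<^sub>M {1..m} (\<lambda>_. restrict_space borel X)"

definition iid_sample :: "(real ^ 'd::finite) measure \<Rightarrow> nat \<Rightarrow> (nat \<Rightarrow> real ^ 'd) measure" where
  "iid_sample P m = Pi\<^sub>M {1..m} (\<lambda>_. P)"

definition half_sample :: "nat \<Rightarrow> nat \<Rightarrow> (nat \<Rightarrow> 'x) \<Rightarrow> (nat \<Rightarrow> 'x)" where
  "half_sample n k xs = restrict (\<lambda>i. xs (k * n + i)) {1..n}"

text \<open>The statistics are computed in \<open>ennreal\<close>: if the denominator vanishes and the numerator does
  not, the ratio is \<open>\<infinity>\<close> and the null hypothesis is rejected (a real-valued quotient would be \<open>0\<close>).
  The argument \<open>\<theta>t k\<close> is the arbitrary estimator and \<open>\<theta>h k\<close> the maximum composite likelihood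
  estimator, each a function of the \<open>k\<close>-th half-sample, \<open>k \<in> {0, 1}\<close>.\<close>

definition split_stat ::
  "('d::finite set \<Rightarrow> 'p \<Rightarrow> ('d \<Rightarrow> real) \<Rightarrow> real)
   \<Rightarrow> ('d set \<times> 'd set \<Rightarrow> 'p \<Rightarrow> ('d \<Rightarrow> real) \<Rightarrow> ('d \<Rightarrow> real) \<Rightarrow> real)
   \<Rightarrow> ('d set \<Rightarrow> real) \<Rightarrow> ('d set \<times> 'd set \<Rightarrow> real) \<Rightarrow> nat
   \<Rightarrow> (nat \<Rightarrow> (nat \<Rightarrow> real ^ 'd) \<Rightarrow> 'p) \<Rightarrow> (nat \<Rightarrow> (nat \<Rightarrow> real ^ 'd) \<Rightarrow> 'p)
   \<Rightarrow> nat \<Rightarrow> (nat \<Rightarrow> real ^ 'd) \<Rightarrow> ennreal" where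
  "split_stat pm pc a b n \<theta>t \<theta>h k xs =
     ennreal (composite_lik pm pc a b n (\<theta>t (1 - k) (half_sample n (1 - k) xs)) (half_sample n k xs)) /
     ennreal (composite_lik pm pc a b n (\<theta>h k (half_sample n k xs)) (half_sample n k xs))"

definition swapped_stat ::
  "('d::finite set \<Rightarrow> 'p \<Rightarrow> ('d \<Rightarrow> real) \<Rightarrow> real)
   \<Rightarrow> ('d set \<times> 'd set \<Rightarrow> 'p \<Rightarrow> ('d \<Rightarrow> real) \<Rightarrow> ('d \<Rightarrow> real) \<Rightarrow> real)
   \<Rightarrow> ('d set \<Rightarrow> real) \<Rightarrow> ('d set \<times> 'd set \<Rightarrow> real) \<Rightarrow> nat
   \<Rightarrow> (nat \<Rightarrow> (nat \<Rightarrow> real ^ 'd) \<Rightarrow> 'p) \<Rightarrow> (nat \<Rightarrow> (nat \<Rightarrow> real ^ 'd) \<Rightarrow> 'p)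
   \<Rightarrow> (nat \<Rightarrow> real ^ 'd) \<Rightarrow> ennreal" where
  "swapped_stat pm pc a b n \<theta>t \<theta>h xs =
     (split_stat pm pc a b n \<theta>t \<theta>h 0 xs + split_stat pm pc a b n \<theta>t \<theta>h 1 xs) / 2"

text \<open>The supremum is taken in \<open>ennreal\<close>, where it always exists.\<close>

definition type_I_error ::
  "('p \<Rightarrow> (real ^ 'd::finite) measure) \<Rightarrow> nat \<Rightarrow> 'p set \<Rightarrow> ((nat \<Rightarrow> real ^ 'd) \<Rightarrow> bool) \<Rightarrow> ennreal" where
  "type_I_error P m \<Theta>0 reject =
     (SUP \<theta>\<in>\<Theta>0. emeasure (iid_sample (P \<theta>) m) {xs \<in> space (iid_sample (P \<theta>) m). reject xs})"

end

theory Submission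
  imports Defs
begin

text \<open>For a fixed \<open>\<theta>\<close>, each marginal or conditional likelihood ratio of \<open>\<theta>\<close> against the true
  parameter \<open>\<theta>\<^sup>*\<close> has \<open>\<theta>\<^sup>*\<close>-expectation at most \<open>1\<close>. The composite likelihood ratio is a weighted
  geometric mean of these ratios, hence bounded by their weighted arithmetic mean, so its
  expectation is at most \<open>1\<close> as well. Under the null hypothesis the maximised denominator of
  \<open>V\<^sup>k\<close> dominates the likelihood of \<open>\<theta>\<^sup>*\<close>; integrating first over the \<open>k\<close>-th half-sample, with the
  estimate from the other half held fixed, gives \<open>E V\<^sup>k \<le> 1\<close>, and the level follows from Markov's
  inequality. Fubini's theorem is applied to \<open>V\<^sup>k\<close> and not to its upper bound, which need not be
  jointly measurable in the two halves.\<close>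

section \<open>Weighted geometric means of density ratios\<close>

text \<open>Jensen's inequality for \<open>exp\<close>, taken at the logarithms of the
  \<open>r i\<close>. Logarithms are available only if no \<open>r i\<close> of nonzero weight
  vanishes; otherwise the product is 0 and the bound is trivial. Factors of weight 0 are 1 by the
  convention of \<open>rpow\<close>.\<close>

lemma weighted_arith_geo_mean:
  fixes r w :: "'i \<Rightarrow> real"
  assumes "finite I" "(\<Sum>i\<in>I. w i) = 1" "\<And>i. i \<in> I \<Longrightarrow> 0 \<le> w i" "\<And>i. i \<in> I \<Longrightarrow> 0 \<le> r i"
  shows "(\<Prod>i\<in>I. rpow (r i) (w i)) \<le> (\<Sum>i\<in>I. w i * r i)"
proof (cases "\<exists>i\<in>I. w i \<noteq> 0 \<and> r i = 0")
  case True
  then have "(\<Prod>i\<in>I. rpow (r i) (w i)) = 0"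
    using assms(1) by (auto simp: rpow_def intro!: prod_zero)
  then show ?thesis
    using assms(3,4) by (auto intro!: sum_nonneg)
next
  case False
  \<comment> \<open>The value 0 at indices of weight 0 is a placeholder: there
    \<open>exp (y i)\<close> need not equal \<open>r i\<close>, but both sums multiply the term by
    0.\<close>
  define y where "y i = (if w i = 0 then 0 else ln (r i))" for i
  have exp_y: "exp (y i) = r i" if "i \<in> I" "w i \<noteq> 0" for i
    using False assms(4)[OF that(1)] that by (auto simp: y_def)
  have "(\<Prod>i\<in>I. rpow (r i) (w i)) = (\<Prod>i\<in>I. exp (w i * y i))"
    using False by (intro prod.cong) (auto simp: rpow_def y_def powr_def)
  also have "\<dots> = exp (\<Sum>i\<in>I. w i *\<^sub>R y i)"
    using assms(1) by (simp add: exp_sum)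
  also have "\<dots> \<le> (\<Sum>i\<in>I. w i * exp (y i))"
    using assms by (intro convex_on_sum[OF _ _ exp_convex]) auto
  also have "\<dots> = (\<Sum>i\<in>I. w i * r i)"
    using exp_y by (intro sum.cong) auto
  finally show ?thesis .
qed

lemma rpow_nonneg [simp]: "0 \<le> rpow x r"
  by (simp add: rpow_def)

lemma rpow_divide: "0 \<le> x \<Longrightarrow> 0 < y \<Longrightarrow> rpow (x / y) r = rpow x r / rpow y r"
  by (simp add: rpow_def powr_divide)

lemma rpow_pos: "0 < x \<Longrightarrow> 0 < rpow x r"
  by (simp add: rpow_def)

lemma borel_measurable_rpow [measurable (raw)]:
  "f \<in> borel_measurable M \<Longrightarrow> (\<lambda>x. rpow (f x) r) \<in> borel_measurable M"
  by (cases "r = 0") (simp_all add: rpow_def)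

text \<open>A quotient of geometric means with common weights is the geometric mean of the
  quotients. The arithmetic mean dominates it almost everywhere, and the integral of that mean is a
  convex combination of numbers at most 1.\<close>

lemma nn_integral_geometric_pool_ratio_le_1:
  fixes f h :: "'i \<Rightarrow> 'x \<Rightarrow> real"
  assumes "finite I" "(\<Sum>i\<in>I. w i) = 1" "\<And>i. i \<in> I \<Longrightarrow> 0 \<le> w i"
    and f: "\<And>i x. i \<in> I \<Longrightarrow> 0 \<le> f i x"
    and meas: "\<And>i. i \<in> I \<Longrightarrow> f i \<in> borel_measurable M" "\<And>i. i \<in> I \<Longrightarrow> h i \<in> borel_measurable M"
    and pos: "\<And>i. i \<in> I \<Longrightarrow> AE x in M. 0 < h i x"
    and ratio: "\<And>i. i \<in> I \<Longrightarrow> (\<integral>\<^sup>+ x. ennreal (f i x / h i x) \<partial>M) \<le> 1"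
  shows "(\<integral>\<^sup>+ x. ennreal (\<Prod>i\<in>I. rpow (f i x) (w i)) / ennreal (\<Prod>i\<in>I. rpow (h i x) (w i)) \<partial>M) \<le> 1"
proof -
  have "AE x in M. \<forall>i\<in>I. 0 < h i x"
    using \<open>finite I\<close> pos by (intro AE_finite_allI) auto
  then have "(\<integral>\<^sup>+ x. ennreal (\<Prod>i\<in>I. rpow (f i x) (w i)) / ennreal (\<Prod>i\<in>I. rpow (h i x) (w i)) \<partial>M)
      \<le> (\<integral>\<^sup>+ x. (\<Sum>i\<in>I. ennreal (w i) * ennreal (f i x / h i x)) \<partial>M)"
  proof (intro nn_integral_mono_AE, eventually_elim)
    case (elim x)
    \<comment> \<open>Off the exceptional null set the denominator is a positive real, so the
      extended quotient is the real one.\<close>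
    have "ennreal (\<Prod>i\<in>I. rpow (f i x) (w i)) / ennreal (\<Prod>i\<in>I. rpow (h i x) (w i))
        = ennreal ((\<Prod>i\<in>I. rpow (f i x) (w i)) / (\<Prod>i\<in>I. rpow (h i x) (w i)))"
      using elim by (intro divide_ennreal prod_nonneg prod_pos) (auto intro: rpow_pos)
    also have "\<dots> = ennreal (\<Prod>i\<in>I. rpow (f i x / h i x) (w i))"
      using elim f by (simp add: rpow_divide prod_dividef)
    also have "\<dots> \<le> ennreal (\<Sum>i\<in>I. w i * (f i x / h i x))"
      using assms elim by (intro ennreal_leI weighted_arith_geo_mean) (auto simp: less_imp_le)
    also have "\<dots> = (\<Sum>i\<in>I. ennreal (w i) * ennreal (f i x / h i x))"
      using assms(3) f elim by (simp add: less_imp_le flip: sum_ennreal ennreal_mult)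
    finally show ?case .
  qed
  also have "\<dots> = (\<Sum>i\<in>I. ennreal (w i) * (\<integral>\<^sup>+ x. ennreal (f i x / h i x) \<partial>M))"
    using meas by (simp add: nn_integral_sum nn_integral_cmult)
  also have "\<dots> \<le> (\<Sum>i\<in>I. ennreal (w i) * 1)"
    using ratio by (intro sum_mono mult_left_mono) auto
  also have "\<dots> = 1"
    using assms by (simp add: sum_ennreal)
  finally show ?thesis .
qed

section \<open>Change of variables for subvectors\<close>

text \<open>The formula for events determines the law of \<open>X\<close>, hence the integral of
  every measurable \<open>g\<close>. The sigma-algebra of \<open>\<nu>\<close> may be strictly finer
  than that of \<open>N\<close>, as for counting measure against the Borel sets; pushing the density
  measure along the identity into \<open>N\<close> makes the two measures comparable.\<close>

lemma nn_integral_law_density: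
  assumes X: "X \<in> measurable M N" and h: "h \<in> borel_measurable \<nu>"
    and "space \<nu> = space N" "sets N \<subseteq> sets \<nu>"
    and law: "\<And>A. A \<in> sets N \<Longrightarrow> emeasure M {x \<in> space M. X x \<in> A} = (\<integral>\<^sup>+ y\<in>A. h y \<partial>\<nu>)"
    and g: "g \<in> borel_measurable N"
  shows "(\<integral>\<^sup>+ x. g (X x) \<partial>M) = (\<integral>\<^sup>+ y. h y * g y \<partial>\<nu>)"
proof -
  have id: "(\<lambda>y. y) \<in> measurable \<nu> N"
    using assms(3,4) by (intro measurableI) (auto simp: sets.Int_space_eq2)
  have "distr M N X = distr (density \<nu> h) N (\<lambda>y. y)"
  proof (rule measure_eqI)
    fix A assume "A \<in> sets (distr M N X)"
    then have A: "A \<in> sets N" by simp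
    then have "emeasure (distr M N X) A = emeasure M {x \<in> space M. X x \<in> A}"
      using X by (simp add: emeasure_distr vimage_def Int_def conj_commute)
    also have "\<dots> = emeasure (density \<nu> h) A"
      using A assms(4) h law by (subst emeasure_density) auto
    also have "\<dots> = emeasure (distr (density \<nu> h) N (\<lambda>y. y)) A"
      using A id assms(3) sets.sets_into_space[OF A]
      by (subst emeasure_distr) (auto intro!: arg_cong[where f = "emeasure _"])
    finally show "emeasure (distr M N X) A = emeasure (distr (density \<nu> h) N (\<lambda>y. y)) A" .
  qed simp
  then have "(\<integral>\<^sup>+ x. g (X x) \<partial>M) = (\<integral>\<^sup>+ y. g y \<partial>distr (density \<nu> h) N (\<lambda>y. y))"
    using X g by (simp flip: nn_integral_distr)
  also have "\<dots> = (\<integral>\<^sup>+ y. g y \<partial>density \<nu> h)"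
    using id g by (subst nn_integral_distr) auto
  also have "\<dots> = (\<integral>\<^sup>+ y. h y * g y \<partial>\<nu>)"
    using h measurable_compose[OF id g] by (subst nn_integral_density) auto
  finally show ?thesis .
qed

lemma space_ref_measure [simp]: "space (ref_measure disc S) = space (subvec_borel S)"
  by (simp add: ref_measure_def space_PiM)

lemma sets_ref_measure_lborel: "sets (ref_measure False S) = sets (subvec_borel S)"
  unfolding ref_measure_def by (auto intro!: sets_PiM_cong)

lemma sets_subvec_borel_subset: "sets (subvec_borel S) \<subseteq> sets (ref_measure disc S)"
proof (cases disc)
  case True
  then show ?thesis
    using sets.sets_into_space[of _ "subvec_borel S"] by (auto simp: ref_measure_def space_PiM)
next
  case False
  then show ?thesis by (simp add: sets_ref_measure_lborel)
qed

lemma borel_measurable_ref_measure: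
  "f \<in> borel_measurable (subvec_borel S) \<Longrightarrow> f \<in> borel_measurable (ref_measure disc S)"
  using sets_subvec_borel_subset[of S disc] by (auto simp: measurable_def)

lemma measurable_subvec:
  assumes "sets P = sets (restrict_space borel X)"
  shows "subvec S \<in> measurable P (subvec_borel S)"
proof -
  have "subvec S \<in> measurable borel (subvec_borel S)"
    unfolding subvec_def[abs_def] by (intro measurable_restrict) simp
  then show ?thesis
    using assms by (subst measurable_cong_sets[OF assms refl]) (rule measurable_restrict_space1)
qed

text \<open>An extensional function is the only point of the product of its singleton values, and
  the product is finite. This makes the atoms of a discrete subvector measurable events.\<close>

lemma singleton_in_sets_subvec_borel:
  assumes "z \<in> space (subvec_borel R)"
  shows "{z} \<in> sets (subvec_borel R)"
proof -
  have "{z} = Pi\<^sub>E R (\<lambda>i. {z i})"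
    using assms by (simp add: space_PiM PiE_iff PiE_singleton)
  then show ?thesis by (simp add: sets_PiM_I_finite)
qed

lemma nn_integral_marginal:
  assumes "sets P = sets (restrict_space borel X)" and "is_marginal_pdf disc P S f"
    and "g \<in> borel_measurable (subvec_borel S)"
  shows "(\<integral>\<^sup>+ x. g (subvec S x) \<partial>P) = (\<integral>\<^sup>+ y. ennreal (f y) * g y \<partial>ref_measure disc S)"
  using assms
  by (intro nn_integral_law_density[where N = "subvec_borel S"] measurable_subvec[OF assms(1)]
      measurable_compose[OF borel_measurable_ref_measure] sets_subvec_borel_subset)
    (auto simp: is_marginal_pdf_def)

lemma nn_integral_marginal_pdf:
  assumes "prob_space P" "sets P = sets (restrict_space borel X)" "is_marginal_pdf disc P S f"
  shows "(\<integral>\<^sup>+ y. ennreal (f y) \<partial>ref_measure disc S) = 1"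
  using nn_integral_marginal[OF assms(2,3), of "\<lambda>_. 1"] prob_space.emeasure_space_1[OF assms(1)]
  by simp

section \<open>Integration against conditional densities\<close>

text \<open>Every point where \<open>f\<close> is nonzero is an atom of the law of the subvector,
  and a finite measure has only countably many atoms. Countability is thus a consequence of having a
  mass function, although the reference measure counts an uncountable space.\<close>

lemma countable_support_discrete_marginal:
  assumes P: "prob_space P" and sets_P: "sets P = sets (restrict_space borel X)"
    and f: "is_marginal_pdf True P R f"
  obtains C where "countable C" "C \<subseteq> space (subvec_borel R)" "AE x in P. subvec R x \<in> C"
proof -
  interpret prob_space P by fact
  note meas = measurable_subvec[OF sets_P]
  let ?C = "{z \<in> space (subvec_borel R). f z \<noteq> 0}"
  let ?N = "{z \<in> space (subvec_borel R). f z = 0}"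
  let ?Q = "distr P (subvec_borel R) (subvec R)"
  have "measure ?Q {z} \<noteq> 0" if "z \<in> ?C" for z
  proof -
    have z: "{z} \<in> sets (subvec_borel R)"
      using that by (intro singleton_in_sets_subvec_borel) auto
    have "emeasure ?Q {z} = emeasure P {x \<in> space P. subvec R x \<in> {z}}"
      using meas z by (simp add: emeasure_distr vimage_def Int_def conj_commute)
    also have "\<dots> = (\<integral>\<^sup>+ y\<in>{z}. ennreal (f y) \<partial>ref_measure True R)"
      using f z by (auto simp: is_marginal_pdf_def)
    also have "\<dots> = ennreal (f z)"
      using that by (simp add: ref_measure_def space_PiM nn_integral_indicator_singleton)
    finally show ?thesis
      using that f by (auto simp: measure_def is_marginal_pdf_def)
  qed
  moreover have "countable {z. measure ?Q {z} \<noteq> 0}"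
    using meas by (intro finite_measure.countable_support prob_space.axioms(1)) (rule prob_space_distr)
  ultimately have C: "countable ?C"
    by (elim countable_subset[rotated]) auto
  have N: "?N \<in> sets (subvec_borel R)"
    using f by (auto simp: is_marginal_pdf_def)
  \<comment> \<open>The subvector almost surely avoids the zero set of its own density, because the
    density integrates to 0 there.\<close>
  have "(\<integral>\<^sup>+ x. indicator ?N (subvec R x) \<partial>P)
      = (\<integral>\<^sup>+ y. ennreal (f y) * indicator ?N y \<partial>ref_measure True R)"
    using N by (intro nn_integral_marginal[OF sets_P f]) simp
  also have "\<dots> = (\<integral>\<^sup>+ y. 0 \<partial>ref_measure True R)"
    by (intro nn_integral_cong) (auto simp: indicator_def)
  finally have "AE x in P. indicator ?N (subvec R x) = (0 :: ennreal)"
    by (simp add: nn_integral_0_iff_AE[OF measurable_compose[OF meas borel_measurable_indicator[OF N]]])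
  then have "AE x in P. subvec R x \<in> ?C"
    using AE_space
    by eventually_elim (use measurable_space[OF meas] in \<open>auto simp: indicator_def split: if_splits\<close>)
  with C show ?thesis by (intro that) auto
qed

text \<open>For counting measure on an uncountable space the inner integral of a kernel need not be known
  to be measurable in \<open>z\<close>. The inequality is therefore proved atom by atom on a countable set that
  carries \<open>X\<^sub>R\<close>.\<close>

lemma nn_integral_conditional_le_discrete:
  assumes P: "prob_space P" and sets_P: "sets P = sets (restrict_space borel X)"
    and m: "is_marginal_pdf True P R m" and f: "is_conditional_pdf True P S R f"
    and g: "g \<in> borel_measurable (subvec_borel S \<Otimes>\<^sub>M subvec_borel R)"
    and bound: "\<And>z. z \<in> space (subvec_borel R) \<Longrightarrow>
      (\<integral>\<^sup>+ y. ennreal (f y z) * g (y, z) \<partial>ref_measure True S) \<le> c"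
  shows "(\<integral>\<^sup>+ x. g (subvec S x, subvec R x) \<partial>P) \<le> c"
proof -
  interpret prob_space P by fact
  note [measurable] = measurable_subvec[OF sets_P] g
  obtain C where C: "countable C" "C \<subseteq> space (subvec_borel R)" "AE x in P. subvec R x \<in> C"
    using countable_support_discrete_marginal[OF P sets_P m] by blast
  define E where "E z = {x \<in> space P. subvec R x = z}" for z
  have singleton: "{z} \<in> sets (subvec_borel R)" if "z \<in> C" for z
    using C that by (intro singleton_in_sets_subvec_borel) auto
  have E [measurable]: "E z \<in> sets P" if "z \<in> C" for z
    using measurable_sets[OF measurable_subvec[OF sets_P] singleton[OF that]]
    by (simp add: E_def vimage_def Int_def conj_commute)
  \<comment> \<open>The fibres \<open>E z\<close> are disjoint, so the sum over \<open>C\<close> has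
    a single nonzero term. This is the device for splitting an expectation over the values of
    \<open>subvec R x\<close>.\<close>
  have sum_C: "h (subvec R x) = (\<integral>\<^sup>+ z. h z * indicator (E z) x \<partial>count_space C)"
    if "subvec R x \<in> C" "x \<in> space P" for h :: "_ \<Rightarrow> ennreal" and x
  proof -
    have "(\<integral>\<^sup>+ z. h z * indicator (E z) x \<partial>count_space C)
        = (\<integral>\<^sup>+ z. h z * indicator {subvec R x} z \<partial>count_space C)"
      using that by (intro nn_integral_cong) (auto simp: E_def indicator_def)
    also have "\<dots> = h (subvec R x)"
      using that by (simp add: nn_integral_indicator_singleton)
    finally show ?thesis ..
  qed
  \<comment> \<open>Testing the conditional density on \<open>B = {z}\<close> shows that
    \<open>P\<close> restricted to the fibre \<open>E z\<close> gives \<open>subvec S\<close> the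
    density \<open>emeasure P (E z) * f y z\<close>. With \<open>z\<close> fixed, only functions of
    \<open>y\<close> remain to be integrated.\<close>
  have slice: "(\<integral>\<^sup>+ x. g (subvec S x, z) * indicator (E z) x \<partial>P) \<le> emeasure P (E z) * c" if z: "z \<in> C" for z
  proof -
    have z': "z \<in> space (subvec_borel R)" using z C by auto
    have gz [measurable]: "(\<lambda>y. g (y, z)) \<in> borel_measurable (subvec_borel S)"
      using z' by measurable
    have "(\<integral>\<^sup>+ x. g (subvec S x, z) * indicator (E z) x \<partial>P)
        = (\<integral>\<^sup>+ x. g (subvec S x, z) \<partial>density P (indicator (E z)))"
      using E[OF z] by (subst nn_integral_density) (auto simp: mult.commute)
    also have "\<dots> = (\<integral>\<^sup>+ y. emeasure P (E z) * ennreal (f y z) * g (y, z) \<partial>ref_measure True S)"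
    proof (intro nn_integral_law_density[where N = "subvec_borel S"] sets_subvec_borel_subset)
      fix A assume A: "A \<in> sets (subvec_borel S)"
      have "emeasure (density P (indicator (E z))) {x \<in> space (density P (indicator (E z))). subvec S x \<in> A}
          = emeasure P {x \<in> space P. subvec S x \<in> A \<and> subvec R x \<in> {z}}"
        using A E[OF z] measurable_sets[OF measurable_subvec[OF sets_P] A]
        by (subst emeasure_density)
          (auto simp: E_def vimage_def Int_def conj_commute nn_integral_indicator
            simp flip: indicator_inter_arith intro!: arg_cong[where f = "emeasure P"])
      also have "\<dots> = (\<integral>\<^sup>+ x\<in>{x \<in> space P. subvec R x \<in> {z}}.
               (\<integral>\<^sup>+ y\<in>A. ennreal (f y (subvec R x)) \<partial>ref_measure True S) \<partial>P)"
        using f A singleton[OF z] unfolding is_conditional_pdf_def by blast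
      \<comment> \<open>On the fibre the inner integral is constant in \<open>x\<close>, so no
        measurability in the conditioning variable is at stake.\<close>
      also have "\<dots> = (\<integral>\<^sup>+ x. (\<integral>\<^sup>+ y\<in>A. ennreal (f y z) \<partial>ref_measure True S) * indicator (E z) x \<partial>P)"
        by (intro nn_integral_cong) (auto simp: E_def indicator_def)
      also have "\<dots> = (\<integral>\<^sup>+ y\<in>A. ennreal (f y z) \<partial>ref_measure True S) * emeasure P (E z)"
        using E[OF z] by (rule nn_integral_cmult_indicator)
      also have "\<dots> = (\<integral>\<^sup>+ y\<in>A. emeasure P (E z) * ennreal (f y z) \<partial>ref_measure True S)"
        by (subst mult.commute, subst nn_integral_cmult[symmetric])
          (auto simp: ref_measure_def mult_ac)
      finally show "emeasure (density P (indicator (E z))) {x \<in> space (density P (indicator (E z))). subvec S x \<in> A}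
          = \<dots>" .
    qed (auto simp: ref_measure_def space_PiM)
    also have "\<dots> = emeasure P (E z) * (\<integral>\<^sup>+ y. ennreal (f y z) * g (y, z) \<partial>ref_measure True S)"
      by (subst nn_integral_cmult[symmetric]) (auto simp: ref_measure_def mult_ac)
    also have "\<dots> \<le> emeasure P (E z) * c"
      using bound[OF z'] by (intro mult_left_mono) auto
    finally show ?thesis .
  qed
  have "(\<integral>\<^sup>+ x. g (subvec S x, subvec R x) \<partial>P)
      = (\<integral>\<^sup>+ x. (\<integral>\<^sup>+ z. g (subvec S x, z) * indicator (E z) x \<partial>count_space C) \<partial>P)"
    using C(3) AE_space by (intro nn_integral_cong_AE, eventually_elim) (auto intro: sum_C[of _ "\<lambda>z. g (subvec S _, z)"])
  \<comment> \<open>Countability of \<open>C\<close> permits exchanging sum and integral; after the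
    fibrewise bound the same exchange is made backwards with the constant \<open>c\<close>.\<close>
  also have "\<dots> = (\<integral>\<^sup>+ z. (\<integral>\<^sup>+ x. g (subvec S x, z) * indicator (E z) x \<partial>P) \<partial>count_space C)"
    using C by (intro nn_integral_count_space_nn_integral) (auto intro!: borel_measurable_times_ennreal)
  also have "\<dots> \<le> (\<integral>\<^sup>+ z. emeasure P (E z) * c \<partial>count_space C)"
    using slice by (intro nn_integral_mono) auto
  also have "\<dots> = (\<integral>\<^sup>+ z. (\<integral>\<^sup>+ x. c * indicator (E z) x \<partial>P) \<partial>count_space C)"
    by (intro nn_integral_cong) (simp add: nn_integral_cmult_indicator mult.commute)
  also have "\<dots> = (\<integral>\<^sup>+ x. (\<integral>\<^sup>+ z. c * indicator (E z) x \<partial>count_space C) \<partial>P)"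
    using C by (intro nn_integral_count_space_nn_integral[symmetric]) auto
  also have "\<dots> = (\<integral>\<^sup>+ x. c \<partial>P)"
    using C(3) AE_space by (intro nn_integral_cong_AE, eventually_elim) (auto intro: sum_C[of _ "\<lambda>_. c", symmetric])
  also have "\<dots> = c"
    by (simp add: emeasure_space_1)
  finally show ?thesis .
qed

text \<open>With \<open>Q\<close> the law of the conditioning subvector, the pair of subvectors has
  density \<open>F\<close> with respect to the product of Lebesgue measure and \<open>Q\<close>.
  Tonelli's theorem then integrates \<open>y\<close> first, and the bound applies for each
  \<open>z\<close>.\<close>

lemma nn_integral_conditional_le_lborel:
  assumes P: "prob_space P" and sets_P: "sets P = sets (restrict_space borel X)"
    and f: "is_conditional_pdf False P S R f"
    and g: "g \<in> borel_measurable (subvec_borel S \<Otimes>\<^sub>M subvec_borel R)"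
    and bound: "\<And>z. z \<in> space (subvec_borel R) \<Longrightarrow>
      (\<integral>\<^sup>+ y. ennreal (f y z) * g (y, z) \<partial>ref_measure False S) \<le> c"
  shows "(\<integral>\<^sup>+ x. g (subvec S x, subvec R x) \<partial>P) \<le> c"
proof -
  interpret P: prob_space P by fact
  let ?\<nu> = "ref_measure False S"
  let ?B = "subvec_borel S \<Otimes>\<^sub>M subvec_borel R"
  define Q where "Q = distr P (subvec_borel R) (subvec R)"
  note [measurable] = measurable_subvec[OF sets_P]
  interpret Q: prob_space Q
    unfolding Q_def by (rule P.prob_space_distr) simp
  interpret lb: product_sigma_finite "\<lambda>_ :: 'd. lborel :: real measure" ..
  interpret \<nu>: sigma_finite_measure ?\<nu>
    unfolding ref_measure_def by (simp add: lb.sigma_finite)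
  interpret pair_sigma_finite ?\<nu> Q ..
  have sets_Q: "sets Q = sets (subvec_borel R)" by (simp add: Q_def)
  have sets_pair [measurable_cong]: "sets (?\<nu> \<Otimes>\<^sub>M Q) = sets ?B"
    by (intro sets_pair_measure_cong sets_ref_measure_lborel sets_Q)
  define F where "F p = ennreal (f (fst p) (snd p))" for p
  have F [measurable]: "F \<in> borel_measurable ?B"
    using f by (simp add: F_def[abs_def] is_conditional_pdf_def split_beta')
  note [measurable] = g
  \<comment> \<open>The definition of a conditional density gives this identity on rectangles, an
    intersection-stable generator. The constant sequence of the full rectangle serves as the
    exhaustion, its mass being finite because the joint law is a probability measure.\<close>
  have joint: "distr P ?B (\<lambda>x. (subvec S x, subvec R x)) = density (?\<nu> \<Otimes>\<^sub>M Q) F"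
  proof (rule measure_eqI_generator_eq[OF
        Int_stable_pair_measure_generator[of "subvec_borel S" "subvec_borel R"], where \<Omega> = "space ?B"
        and A = "\<lambda>_. space (subvec_borel S) \<times> space (subvec_borel R)"])
    fix Z assume "Z \<in> {a \<times> b |a b. a \<in> sets (subvec_borel S) \<and> b \<in> sets (subvec_borel R)}"
    then obtain A B where Z: "Z = A \<times> B" and A [measurable]: "A \<in> sets (subvec_borel S)"
      and B [measurable]: "B \<in> sets (subvec_borel R)" by auto
    have [measurable]: "A \<in> sets ?\<nu>" "B \<in> sets Q"
      using A B by (simp_all add: sets_ref_measure_lborel sets_Q)
    have meas_AB: "(\<lambda>p. F p * indicator (A \<times> B) p) \<in> borel_measurable (?\<nu> \<Otimes>\<^sub>M Q)"
      by measurable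
    have "emeasure (density (?\<nu> \<Otimes>\<^sub>M Q) F) Z = (\<integral>\<^sup>+ p. F p * indicator (A \<times> B) p \<partial>(?\<nu> \<Otimes>\<^sub>M Q))"
      unfolding Z by (rule emeasure_density) measurable
    also have "\<dots> = (\<integral>\<^sup>+ z. (\<integral>\<^sup>+ y. F (y, z) * indicator (A \<times> B) (y, z) \<partial>?\<nu>) \<partial>Q)"
      by (rule nn_integral_snd[symmetric]) measurable
    also have "\<dots> = (\<integral>\<^sup>+ x. (\<integral>\<^sup>+ y. F (y, subvec R x) * indicator (A \<times> B) (y, subvec R x) \<partial>?\<nu>) \<partial>P)"
      unfolding Q_def
    proof (rule nn_integral_distr)
      \<comment> \<open>Here sigma-finiteness of \<open>?\<nu>\<close> makes the inner integral
        measurable in \<open>z\<close>.\<close>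
      show "(\<lambda>z. \<integral>\<^sup>+ y. F (y, z) * indicator (A \<times> B) (y, z) \<partial>?\<nu>)
          \<in> borel_measurable (distr P (subvec_borel R) (subvec R))"
        using \<nu>.borel_measurable_nn_integral_fst[OF measurable_pair_swap[OF meas_AB]]
        by (simp add: Q_def)
    qed simp
    also have "\<dots> = (\<integral>\<^sup>+ x\<in>{x \<in> space P. subvec R x \<in> B}.
               (\<integral>\<^sup>+ y\<in>A. ennreal (f y (subvec R x)) \<partial>?\<nu>) \<partial>P)"
      by (intro nn_integral_cong) (auto simp: F_def indicator_def)
    also have "\<dots> = emeasure P {x \<in> space P. subvec S x \<in> A \<and> subvec R x \<in> B}"
      using f A B by (auto simp: is_conditional_pdf_def)
    also have "\<dots> = emeasure (distr P ?B (\<lambda>x. (subvec S x, subvec R x))) Z"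
      unfolding Z by (subst emeasure_distr) (auto intro!: arg_cong[where f = "emeasure P"])
    finally show "emeasure (distr P ?B (\<lambda>x. (subvec S x, subvec R x))) Z
        = emeasure (density (?\<nu> \<Otimes>\<^sub>M Q) F) Z" ..
  next
    interpret J: prob_space "distr P ?B (\<lambda>x. (subvec S x, subvec R x))"
      by (rule P.prob_space_distr) measurable
    show "emeasure (distr P ?B (\<lambda>x. (subvec S x, subvec R x)))
        (space (subvec_borel S) \<times> space (subvec_borel R)) \<noteq> \<infinity>"
      by (simp add: J.emeasure_eq_measure)
  next
    have gen: "sets ?B = sigma_sets (space ?B)
        {a \<times> b |a b. a \<in> sets (subvec_borel S) \<and> b \<in> sets (subvec_borel R)}"
      by (simp add: sets_pair_measure space_pair_measure)
    show "sets (distr P ?B (\<lambda>x. (subvec S x, subvec R x))) = sigma_sets (space ?B)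
        {a \<times> b |a b. a \<in> sets (subvec_borel S) \<and> b \<in> sets (subvec_borel R)}"
      "sets (density (?\<nu> \<Otimes>\<^sub>M Q) F) = sigma_sets (space ?B)
        {a \<times> b |a b. a \<in> sets (subvec_borel S) \<and> b \<in> sets (subvec_borel R)}"
      unfolding gen[symmetric] by (simp_all add: sets_pair)
  qed (use sets.sets_into_space in \<open>fastforce simp: space_pair_measure\<close>)+
  have "(\<integral>\<^sup>+ x. g (subvec S x, subvec R x) \<partial>P) = (\<integral>\<^sup>+ p. g p \<partial>density (?\<nu> \<Otimes>\<^sub>M Q) F)"
    unfolding joint[symmetric] by (rule nn_integral_distr[symmetric]) measurable
  also have "\<dots> = (\<integral>\<^sup>+ p. F p * g p \<partial>(?\<nu> \<Otimes>\<^sub>M Q))"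
    by (rule nn_integral_density) measurable
  also have "\<dots> = (\<integral>\<^sup>+ z. (\<integral>\<^sup>+ y. F (y, z) * g (y, z) \<partial>?\<nu>) \<partial>Q)"
    by (rule nn_integral_snd[symmetric]) measurable
  also have "\<dots> \<le> (\<integral>\<^sup>+ z. c \<partial>Q)"
    using bound by (intro nn_integral_mono) (simp add: F_def Q_def)
  also have "\<dots> = c"
    by (simp add: Q.emeasure_space_1)
  finally show ?thesis .
qed

lemma nn_integral_conditional_le:
  assumes "prob_space P" "sets P = sets (restrict_space borel X)"
    and "is_marginal_pdf disc P R m" "is_conditional_pdf disc P S R f"
    and "g \<in> borel_measurable (subvec_borel S \<Otimes>\<^sub>M subvec_borel R)"
    and "\<And>z. z \<in> space (subvec_borel R) \<Longrightarrow>
      (\<integral>\<^sup>+ y. ennreal (f y z) * g (y, z) \<partial>ref_measure disc S) \<le> c"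
  shows "(\<integral>\<^sup>+ x. g (subvec S x, subvec R x) \<partial>P) \<le> c"
  using assms by (cases disc)
    (auto intro: nn_integral_conditional_le_discrete nn_integral_conditional_le_lborel)

section \<open>Likelihood ratios: marginal, conditional, composite\<close>

text \<open>Equality holds for \<open>v > 0\<close>; at \<open>v = 0\<close> the left side is 0. In
  the integrated form the loss is the mass of the numerator density where the denominator density
  vanishes.\<close>

lemma ennreal_mult_ratio_le:
  fixes u v :: real
  assumes "0 \<le> u" "0 \<le> v"
  shows "ennreal v * ennreal (u / v) \<le> ennreal u"
  using assms by (cases "v = 0") (simp_all flip: ennreal_mult)

text \<open>Integrating the ratio against \<open>f\<close> cancels the denominator and leaves at
  most the total mass 1 of \<open>f'\<close>. The zero set of \<open>f\<close> carries no
  \<open>P\<close>-probability, so the denominator is almost surely positive.\<close>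

lemma marginal_likelihood_ratio:
  assumes P: "prob_space P" "sets P = sets (restrict_space borel X)"
    and P': "prob_space P'" "sets P' = sets (restrict_space borel X)"
    and f: "is_marginal_pdf disc P S f" and f': "is_marginal_pdf disc P' S f'"
  shows "AE x in P. 0 < f (subvec S x)"
    and "(\<integral>\<^sup>+ x. ennreal (f' (subvec S x) / f (subvec S x)) \<partial>P) \<le> 1"
proof -
  note nonneg = f[unfolded is_marginal_pdf_def, THEN conjunct2, THEN conjunct1, rule_format]
    f'[unfolded is_marginal_pdf_def, THEN conjunct2, THEN conjunct1, rule_format]
  have [measurable]: "f \<in> borel_measurable (subvec_borel S)" "f' \<in> borel_measurable (subvec_borel S)"
    using f f' by (auto simp: is_marginal_pdf_def)
  note [measurable] = measurable_subvec[OF P(2)]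
  have "(\<integral>\<^sup>+ x. indicator {0} (f (subvec S x)) \<partial>P)
      = (\<integral>\<^sup>+ y. ennreal (f y) * indicator {0} (f y) \<partial>ref_measure disc S)"
    by (rule nn_integral_marginal[OF P(2) f]) measurable
  also have "\<dots> = (\<integral>\<^sup>+ y. 0 \<partial>ref_measure disc S)"
    by (intro nn_integral_cong) (auto simp: indicator_def)
  finally have "AE x in P. indicator {0} (f (subvec S x)) = (0 :: ennreal)"
    by (simp add: nn_integral_0_iff_AE)
  then show "AE x in P. 0 < f (subvec S x)"
    by eventually_elim (use nonneg(1) in \<open>auto simp: indicator_def order_less_le split: if_splits\<close>)
  have "(\<integral>\<^sup>+ x. ennreal (f' (subvec S x) / f (subvec S x)) \<partial>P)
      = (\<integral>\<^sup>+ y. ennreal (f y) * ennreal (f' y / f y) \<partial>ref_measure disc S)"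
    by (rule nn_integral_marginal[OF P(2) f, where g = "\<lambda>y. ennreal (f' y / f y)"]) measurable
  also have "\<dots> \<le> (\<integral>\<^sup>+ y. ennreal (f' y) \<partial>ref_measure disc S)"
    by (intro nn_integral_mono ennreal_mult_ratio_le nonneg)
  also have "\<dots> = 1"
    by (rule nn_integral_marginal_pdf[OF P' f'])
  finally show "(\<integral>\<^sup>+ x. ennreal (f' (subvec S x) / f (subvec S x)) \<partial>P) \<le> 1" .
qed

text \<open>The marginal argument, carried out in each slice \<open>z\<close>. The slice bound uses
  that \<open>f'\<close> is a density in \<open>y\<close> for every \<open>z\<close>: the
  conditioning value is drawn under \<open>P\<close>, whose law may charge sets that are null under
  \<open>P'\<close>.\<close>

lemma conditional_likelihood_ratio:
  assumes P: "prob_space P" "sets P = sets (restrict_space borel X)"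
    and m: "is_marginal_pdf disc P R m"
    and f: "is_conditional_pdf disc P S R f" and f': "is_conditional_pdf disc P' S R f'"
  shows "AE x in P. 0 < f (subvec S x) (subvec R x)"
    and "(\<integral>\<^sup>+ x. ennreal (f' (subvec S x) (subvec R x) / f (subvec S x) (subvec R x)) \<partial>P) \<le> 1"
proof -
  note nonneg = f[unfolded is_conditional_pdf_def, THEN conjunct2, THEN conjunct1, rule_format]
    f'[unfolded is_conditional_pdf_def, THEN conjunct2, THEN conjunct1, rule_format]
  have [measurable]:
    "(\<lambda>p. f (fst p) (snd p)) \<in> borel_measurable (subvec_borel S \<Otimes>\<^sub>M subvec_borel R)"
    "(\<lambda>p. f' (fst p) (snd p)) \<in> borel_measurable (subvec_borel S \<Otimes>\<^sub>M subvec_borel R)"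
    using f f' by (auto simp: is_conditional_pdf_def split_beta')
  have pair [measurable]: "(\<lambda>x. (subvec S x, subvec R x)) \<in> measurable P (subvec_borel S \<Otimes>\<^sub>M subvec_borel R)"
    by (intro measurable_Pair measurable_subvec[OF P(2)])
  let ?g0 = "\<lambda>p. indicator {0} (f (fst p) (snd p)) :: ennreal"
  have g0: "?g0 \<in> borel_measurable (subvec_borel S \<Otimes>\<^sub>M subvec_borel R)"
    by measurable
  \<comment> \<open>The slice bound with \<open>c = 0\<close> shows that the zero set of
    \<open>f\<close> is null.\<close>
  have "(\<integral>\<^sup>+ x. ?g0 (subvec S x, subvec R x) \<partial>P) \<le> 0"
  proof (rule nn_integral_conditional_le[OF P m f g0])
    fix z
    have "(\<integral>\<^sup>+ y. ennreal (f y z) * ?g0 (y, z) \<partial>ref_measure disc S) = (\<integral>\<^sup>+ y. 0 \<partial>ref_measure disc S)"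
      by (intro nn_integral_cong) (auto simp: indicator_def)
    then show "(\<integral>\<^sup>+ y. ennreal (f y z) * ?g0 (y, z) \<partial>ref_measure disc S) \<le> 0"
      by simp
  qed
  then have "AE x in P. ?g0 (subvec S x, subvec R x) = 0"
    by (simp add: nn_integral_0_iff_AE[OF measurable_compose[OF pair g0], simplified])
  then show "AE x in P. 0 < f (subvec S x) (subvec R x)"
    by eventually_elim (use nonneg(1) in \<open>auto simp: indicator_def order_less_le split: if_splits\<close>)
  let ?g = "\<lambda>p. ennreal (f' (fst p) (snd p) / f (fst p) (snd p))"
  have "(\<integral>\<^sup>+ x. ?g (subvec S x, subvec R x) \<partial>P) \<le> 1"
  proof (rule nn_integral_conditional_le[OF P m f])
    fix z assume z: "z \<in> space (subvec_borel R)"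
    have "(\<integral>\<^sup>+ y. ennreal (f y z) * ?g (y, z) \<partial>ref_measure disc S)
        \<le> (\<integral>\<^sup>+ y. ennreal (f' y z) \<partial>ref_measure disc S)"
      by (intro nn_integral_mono) (simp add: ennreal_mult_ratio_le nonneg)
    also have "\<dots> = 1"
      using f' z by (auto simp: is_conditional_pdf_def)
    finally show "(\<integral>\<^sup>+ y. ennreal (f y z) * ?g (y, z) \<partial>ref_measure disc S) \<le> 1" .
  qed measurable
  then show "(\<integral>\<^sup>+ x. ennreal (f' (subvec S x) (subvec R x) / f (subvec S x) (subvec R x)) \<partial>P) \<le> 1"
    by simp
qed

lemma measurable_marginal_pdf_subvec:
  assumes "sets P = sets (restrict_space borel X)" "is_marginal_pdf disc P' S f"
  shows "(\<lambda>x. f (subvec S x)) \<in> borel_measurable P"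
  using assms(2)
  by (intro measurable_compose[OF measurable_subvec[OF assms(1)]]) (simp add: is_marginal_pdf_def)

lemma measurable_conditional_pdf_subvec:
  assumes "sets P = sets (restrict_space borel X)" "is_conditional_pdf disc P' S R f"
  shows "(\<lambda>x. f (subvec S x) (subvec R x)) \<in> borel_measurable P"
proof -
  have "(\<lambda>(y, z). f y z) \<in> borel_measurable (subvec_borel S \<Otimes>\<^sub>M subvec_borel R)"
    using assms(2) by (simp add: is_conditional_pdf_def)
  from measurable_compose[OF measurable_Pair[OF measurable_subvec[OF assms(1)] measurable_subvec[OF assms(1)]] this]
  show ?thesis by simp
qed

lemma composite_pdf_nonneg: "0 \<le> composite_pdf pm pc a b \<theta> x"
  unfolding composite_pdf_def by (intro mult_nonneg_nonneg prod_nonneg) auto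

lemma composite_likelihood_ratio:
  fixes pm :: "'d::finite set \<Rightarrow> 'p \<Rightarrow> ('d \<Rightarrow> real) \<Rightarrow> real"
  assumes prob: "\<And>\<theta>. \<theta> \<in> \<Theta> \<Longrightarrow> prob_space (P \<theta>)"
    and sets_P: "\<And>\<theta>. \<theta> \<in> \<Theta> \<Longrightarrow> sets (P \<theta>) = sets (restrict_space borel X)"
    and marginal: "\<And>\<theta> S. \<theta> \<in> \<Theta> \<Longrightarrow> S \<in> nonempty_subsets
      \<Longrightarrow> is_marginal_pdf disc (P \<theta>) S (pm S \<theta>)"
    and conditional: "\<And>\<theta> S R. \<theta> \<in> \<Theta> \<Longrightarrow> (S, R) \<in> disjoint_pairs
      \<Longrightarrow> is_conditional_pdf disc (P \<theta>) S R (pc (S, R) \<theta>)"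
    and weights: "\<And>S. S \<in> nonempty_subsets \<Longrightarrow> 0 \<le> a S"
      "\<And>T. T \<in> disjoint_pairs \<Longrightarrow> 0 \<le> b T"
      "total_weight a b > 0"
    and \<theta>: "\<theta> \<in> \<Theta>" and \<theta>': "\<theta>' \<in> \<Theta>"
  shows "(\<lambda>x. ennreal (composite_pdf pm pc a b \<theta>' x) / ennreal (composite_pdf pm pc a b \<theta> x))
      \<in> borel_measurable (P \<theta>)"
    and "(\<integral>\<^sup>+ x. ennreal (composite_pdf pm pc a b \<theta>' x) / ennreal (composite_pdf pm pc a b \<theta> x) \<partial>P \<theta>) \<le> 1"
proof -
  \<comment> \<open>The disjoint sum of the two index families turns both products into one
    geometric mean, whose weights, normalised by \<open>total_weight a b\<close>, sum to 1.\<close>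
  define I where "I = (nonempty_subsets :: 'd set set) <+> (disjoint_pairs :: ('d set \<times> 'd set) set)"
  define w where "w i = (case i of Inl S \<Rightarrow> a S | Inr T \<Rightarrow> b T) / total_weight a b" for i
  define f where "f t i x = (case i of Inl S \<Rightarrow> pm S t (subvec S x)
      | Inr T \<Rightarrow> pc T t (subvec (fst T) x) (subvec (snd T) x))" for t i and x :: "real ^ 'd"
  have composite: "composite_pdf pm pc a b t x = (\<Prod>i\<in>I. rpow (f t i x) (w i))" for t x
    by (simp add: composite_pdf_def I_def f_def w_def prod.Plus)
  have w_sum: "(\<Sum>i\<in>I. w i) = 1"
    using weights(3) by (simp add: I_def w_def sum.Plus total_weight_def flip: sum_divide_distrib add_divide_distrib)
  have w_nonneg: "0 \<le> w i" if "i \<in> I" for i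
    using that weights by (auto simp: I_def w_def)
  have f_nonneg: "0 \<le> f \<theta>' i x" if "i \<in> I" for i x
    using that marginal[OF \<theta>'] conditional[OF \<theta>']
    by (auto simp: I_def f_def is_marginal_pdf_def is_conditional_pdf_def)
  have f_meas: "f t i \<in> borel_measurable (P \<theta>)" if "t \<in> \<Theta>" "i \<in> I" for t i
    using that measurable_marginal_pdf_subvec[OF sets_P[OF \<theta>] marginal]
      measurable_conditional_pdf_subvec[OF sets_P[OF \<theta>] conditional]
    by (auto simp: I_def f_def[abs_def])
  \<comment> \<open>Conditioning sets are non-empty, so their subvectors have a marginal density; in
    the discrete case it supplies the countable support.\<close>
  have marginal_snd: "is_marginal_pdf disc (P \<theta>) R (pm R \<theta>)" if "(S, R) \<in> disjoint_pairs" for S R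
    using that \<theta> by (intro marginal) (auto simp: disjoint_pairs_def nonempty_subsets_def)
  have pos: "AE x in P \<theta>. 0 < f \<theta> i x" if "i \<in> I" for i
    using that
      marginal_likelihood_ratio(1)[OF prob sets_P prob sets_P marginal marginal, OF \<theta> \<theta> \<theta> \<theta> \<theta> _ \<theta>]
      conditional_likelihood_ratio(1)[OF prob sets_P marginal_snd conditional conditional, OF \<theta> \<theta> _ \<theta> _ \<theta>]
    by (auto simp: I_def f_def)
  have ratio: "(\<integral>\<^sup>+ x. ennreal (f \<theta>' i x / f \<theta> i x) \<partial>P \<theta>) \<le> 1" if "i \<in> I" for i
    using that
      marginal_likelihood_ratio(2)[OF prob sets_P prob sets_P marginal marginal, OF \<theta> \<theta> \<theta>' \<theta>' \<theta> _ \<theta>']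
      conditional_likelihood_ratio(2)[OF prob sets_P marginal_snd conditional conditional, OF \<theta> \<theta> _ \<theta> _ \<theta>']
    by (auto simp: I_def f_def)
  have "finite I" by (simp add: I_def)
  show "(\<integral>\<^sup>+ x. ennreal (composite_pdf pm pc a b \<theta>' x) / ennreal (composite_pdf pm pc a b \<theta> x) \<partial>P \<theta>) \<le> 1"
    unfolding composite
    by (intro nn_integral_geometric_pool_ratio_le_1 \<open>finite I\<close> w_sum w_nonneg f_nonneg f_meas pos ratio \<theta> \<theta>')
  show "(\<lambda>x. ennreal (composite_pdf pm pc a b \<theta>' x) / ennreal (composite_pdf pm pc a b \<theta> x))
      \<in> borel_measurable (P \<theta>)"
    unfolding composite using f_meas[OF \<theta>] f_meas[OF \<theta>'] by measurable
qed

section \<open>Sample splitting and Markov's inequality\<close>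

text \<open>Inversion of extended nonnegative reals is multiplicative on finite values, zero
  included; it fails only for 0 times infinity, which cannot occur here. Vanishing likelihoods are
  therefore covered.\<close>

lemma prod_ennreal_divide:
  assumes "\<And>i. i \<in> I \<Longrightarrow> 0 \<le> u i" "\<And>i. i \<in> I \<Longrightarrow> 0 \<le> v i"
  shows "(\<Prod>i\<in>I. ennreal (u i) / ennreal (v i)) = ennreal (\<Prod>i\<in>I. u i) / ennreal (\<Prod>i\<in>I. v i)"
  using assms
proof (induction I rule: infinite_finite_induct)
  case (insert i I)
  then show ?case
    by (simp add: divide_ennreal_def ennreal_mult prod_nonneg ennreal_inverse_mult mult_ac)
qed (auto simp: divide_ennreal_def)

lemma inverse_antimono_ennreal: "b \<le> c \<Longrightarrow> inverse c \<le> inverse (b :: ennreal)"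
  by (simp add: less_eq_ennreal.rep_eq inverse_ennreal.rep_eq ereal_inverse_antimono enn2ereal_nonneg)

lemma divide_left_antimono_ennreal: "b \<le> c \<Longrightarrow> a / c \<le> a / (b :: ennreal)"
  unfolding divide_ennreal_def by (intro mult_left_mono inverse_antimono_ennreal) auto

text \<open>\<open>I\<close> indexes the half that produces the estimate and \<open>J\<close> the
  half on which it is evaluated. For fixed \<open>ys\<close> the bound factorises over the
  independent coordinates in \<open>J\<close>, and each factor has integral at most 1. The choice of
  \<open>\<rho>\<close> may depend on \<open>ys\<close> in any manner.\<close>

lemma nn_integral_cross_fit_le_1:
  assumes P: "prob_space P" and fin: "finite I" "finite J" "I \<inter> J = {}"
    and V: "V \<in> borel_measurable (Pi\<^sub>M (I \<union> J) (\<lambda>_. P))"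
    and bound: "\<And>ys. ys \<in> space (Pi\<^sub>M I (\<lambda>_. P)) \<Longrightarrow>
      \<exists>\<rho> \<in> borel_measurable P. (\<integral>\<^sup>+ x. \<rho> x \<partial>P) \<le> 1 \<and>
        (\<forall>zs \<in> space (Pi\<^sub>M J (\<lambda>_. P)). V (merge I J (ys, zs)) \<le> (\<Prod>j\<in>J. \<rho> (zs j)))"
  shows "(\<integral>\<^sup>+ xs. V xs \<partial>Pi\<^sub>M (I \<union> J) (\<lambda>_. P)) \<le> 1"
proof -
  interpret P: prob_space P by fact
  interpret product_sigma_finite "\<lambda>_. P" ..
  interpret I: prob_space "Pi\<^sub>M I (\<lambda>_. P)"
    by (intro prob_space_PiM P)
  have "(\<integral>\<^sup>+ xs. V xs \<partial>Pi\<^sub>M (I \<union> J) (\<lambda>_. P))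
      = (\<integral>\<^sup>+ ys. (\<integral>\<^sup>+ zs. V (merge I J (ys, zs)) \<partial>Pi\<^sub>M J (\<lambda>_. P)) \<partial>Pi\<^sub>M I (\<lambda>_. P))"
    using fin V by (intro product_nn_integral_fold) auto
  also have "\<dots> \<le> (\<integral>\<^sup>+ ys. 1 \<partial>Pi\<^sub>M I (\<lambda>_. P))"
  proof (rule nn_integral_mono)
    fix ys assume "ys \<in> space (Pi\<^sub>M I (\<lambda>_. P))"
    then obtain \<rho> where \<rho>: "\<rho> \<in> borel_measurable P" "(\<integral>\<^sup>+ x. \<rho> x \<partial>P) \<le> 1"
      "\<And>zs. zs \<in> space (Pi\<^sub>M J (\<lambda>_. P)) \<Longrightarrow> V (merge I J (ys, zs)) \<le> (\<Prod>j\<in>J. \<rho> (zs j))"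
      using bound by blast
    have "(\<integral>\<^sup>+ zs. V (merge I J (ys, zs)) \<partial>Pi\<^sub>M J (\<lambda>_. P))
        \<le> (\<integral>\<^sup>+ zs. (\<Prod>j\<in>J. \<rho> (zs j)) \<partial>Pi\<^sub>M J (\<lambda>_. P))"
      using \<rho>(3) by (rule nn_integral_mono)
    also have "\<dots> = (\<Prod>j\<in>J. \<integral>\<^sup>+ x. \<rho> x \<partial>P)"
      using fin \<rho>(1) by (intro product_nn_integral_prod) auto
    also have "\<dots> \<le> (\<Prod>j\<in>J. 1)"
      using \<rho>(2) by (intro prod_mono_ennreal) auto
    finally show "(\<integral>\<^sup>+ zs. V (merge I J (ys, zs)) \<partial>Pi\<^sub>M J (\<lambda>_. P)) \<le> 1"
      by simp
  qed
  also have "\<dots> = 1"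
    by (simp add: I.emeasure_space_1)
  finally show ?thesis .
qed

lemma emeasure_exceeds_inverse_level_le:
  assumes "0 < \<alpha>" and V: "V \<in> borel_measurable M" and "(\<integral>\<^sup>+ x. V x \<partial>M) \<le> 1"
  shows "emeasure M {x \<in> space M. V x > ennreal (1 / \<alpha>)} \<le> ennreal \<alpha>"
proof -
  have "1 \<le> ennreal \<alpha> * v" if "v > ennreal (1 / \<alpha>)" for v
  proof -
    have "1 = ennreal \<alpha> * ennreal (1 / \<alpha>)"
      using \<open>0 < \<alpha>\<close> by (simp flip: ennreal_mult)
    also have "\<dots> \<le> ennreal \<alpha> * v"
      using that by (intro mult_left_mono) auto
    finally show ?thesis .
  qed
  then have "emeasure M {x \<in> space M. V x > ennreal (1 / \<alpha>)}
      \<le> emeasure M {x \<in> space M. 1 \<le> ennreal \<alpha> * V x}"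
    using V by (intro emeasure_mono) auto
  also have "\<dots> \<le> ennreal \<alpha> * (\<integral>\<^sup>+ x. V x * indicator (space M) x \<partial>M)"
    using V by (intro nn_integral_Markov_inequality) auto
  also have "\<dots> = ennreal \<alpha> * (\<integral>\<^sup>+ x. V x \<partial>M)"
    by (intro arg_cong2[where f = "(*)"] nn_integral_cong) auto
  also have "\<dots> \<le> ennreal \<alpha>"
    using mult_left_mono[OF assms(3), of "ennreal \<alpha>"] by simp
  finally show ?thesis .
qed

section \<open>Level of the split and swapped tests\<close>

theorem proposition2:
  fixes X :: "(real ^ 'd::finite) set"
    and \<Theta> \<Theta>0 :: "(real ^ 'q::finite) set"
    and P :: "real ^ 'q \<Rightarrow> (real ^ 'd) measure"
    and disc :: bool
    and pm :: "'d set \<Rightarrow> real ^ 'q \<Rightarrow> ('d \<Rightarrow> real) \<Rightarrow> real"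
    and pc :: "'d set \<times> 'd set \<Rightarrow> real ^ 'q \<Rightarrow> ('d \<Rightarrow> real) \<Rightarrow> ('d \<Rightarrow> real) \<Rightarrow> real"
    and a :: "'d set \<Rightarrow> real"
    and b :: "'d set \<times> 'd set \<Rightarrow> real"
    and n :: nat
    and \<theta>t \<theta>h :: "nat \<Rightarrow> (nat \<Rightarrow> real ^ 'd) \<Rightarrow> real ^ 'q"
    and \<alpha> :: real
  assumes level: "0 < \<alpha>" "\<alpha> < 1"
    and null: "\<Theta>0 \<subseteq> \<Theta>"
    and family: "\<And>\<theta>. \<theta> \<in> \<Theta> \<Longrightarrow> prob_space (P \<theta>)"
      "\<And>\<theta>. \<theta> \<in> \<Theta> \<Longrightarrow> sets (P \<theta>) = sets (restrict_space borel X)"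
    and marginal: "\<And>\<theta> S. \<theta> \<in> \<Theta> \<Longrightarrow> S \<in> nonempty_subsets
      \<Longrightarrow> is_marginal_pdf disc (P \<theta>) S (pm S \<theta>)"
    and conditional: "\<And>\<theta> S R. \<theta> \<in> \<Theta> \<Longrightarrow> (S, R) \<in> disjoint_pairs
      \<Longrightarrow> is_conditional_pdf disc (P \<theta>) S R (pc (S, R) \<theta>)"
    and weights: "\<And>S. S \<in> nonempty_subsets \<Longrightarrow> 0 \<le> a S"
      "\<And>T. T \<in> disjoint_pairs \<Longrightarrow> 0 \<le> b T"
      "total_weight a b > 0"
    and estimator: "\<And>k. k \<in> {0, 1}
      \<Longrightarrow> \<theta>t k \<in> measurable (sample_space X n) (restrict_space borel \<Theta>)"
    and mcle_measurable: "\<And>k. k \<in> {0, 1}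
      \<Longrightarrow> \<theta>h k \<in> measurable (sample_space X n) (restrict_space borel \<Theta>0)"
    and mcle: "\<And>k ys. k \<in> {0, 1} \<Longrightarrow> ys \<in> space (sample_space X n)
      \<Longrightarrow> is_arg_max (\<lambda>\<theta>. composite_lik pm pc a b n \<theta> ys) (\<lambda>\<theta>. \<theta> \<in> \<Theta>0) (\<theta>h k ys)"
    and statistic: "\<And>k. k \<in> {0, 1}
      \<Longrightarrow> split_stat pm pc a b n \<theta>t \<theta>h k \<in> borel_measurable (sample_space X (2 * n))"
  shows "type_I_error P (2 * n) \<Theta>0
           (\<lambda>xs. split_stat pm pc a b n \<theta>t \<theta>h 0 xs > ennreal (1 / \<alpha>)) \<le> ennreal \<alpha> \<and>
         type_I_error P (2 * n) \<Theta>0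
           (\<lambda>xs. swapped_stat pm pc a b n \<theta>t \<theta>h xs > ennreal (1 / \<alpha>)) \<le> ennreal \<alpha>"
proof -
  have "0 < \<alpha>" by fact
  have space_P: "space (P \<theta>) = X" if "\<theta> \<in> \<Theta>" for \<theta>
    using sets_eq_imp_space_eq[OF family(2)[OF that]] by (simp add: space_restrict_space)
  have space_sample: "space (sample_space X m) = PiE {1..m} (\<lambda>_. X)" for m
    by (simp add: sample_space_def space_PiM space_restrict_space)
  define V where "V = split_stat pm pc a b n \<theta>t \<theta>h"
  \<comment> \<open>The positions of the \<open>k\<close>-th half in the full sample;
    \<open>half_sample\<close> shifts them by \<open>k * n\<close> to the positions 1 to
    \<open>n\<close>.\<close>
  define H where "H k = {k * n + 1..k * n + n}" for k
  have half_space: "half_sample n k xs \<in> space (sample_space X n)"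
    if "\<And>j. j \<in> H k \<Longrightarrow> xs j \<in> X" for k xs
    using that by (auto simp: space_sample half_sample_def H_def)
  \<comment> \<open>The null hypothesis enters here: \<theta> lies in \<open>\<Theta>0\<close>, so
    the maximised denominator is at least the likelihood of \<theta>. The bound is pointwise and
    holds with infinite ratios too.\<close>
  have V_le: "V k xs \<le> (\<Prod>j\<in>H k.
      ennreal (composite_pdf pm pc a b (\<theta>t (1 - k) (half_sample n (1 - k) xs)) (xs j)) /
      ennreal (composite_pdf pm pc a b \<theta> (xs j)))"
    if "\<theta> \<in> \<Theta>0" "k \<in> {0, 1}" "\<And>j. j \<in> H k \<Longrightarrow> xs j \<in> X" for \<theta> k xs
  proof -
    let ?t = "\<theta>t (1 - k) (half_sample n (1 - k) xs)" and ?ys = "half_sample n k xs"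
    have lik: "composite_lik pm pc a b n t ?ys = (\<Prod>j\<in>H k. composite_pdf pm pc a b t (xs j))" for t
      unfolding composite_lik_def H_def
      by (rule prod.reindex_bij_witness[of _ "\<lambda>j. j - k * n" "\<lambda>i. k * n + i"])
        (auto simp: half_sample_def)
    have "composite_lik pm pc a b n \<theta> ?ys \<le> composite_lik pm pc a b n (\<theta>h k ?ys) ?ys"
      using mcle[OF that(2) half_space[OF that(3)]] that(1) by (auto simp: is_arg_max_def not_less)
    then have "V k xs \<le> ennreal (composite_lik pm pc a b n ?t ?ys) / ennreal (composite_lik pm pc a b n \<theta> ?ys)"
      unfolding V_def split_stat_def by (intro divide_left_antimono_ennreal ennreal_leI)
    also have "\<dots> = (\<Prod>j\<in>H k. ennreal (composite_pdf pm pc a b ?t (xs j)) /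
        ennreal (composite_pdf pm pc a b \<theta> (xs j)))"
      unfolding lik by (intro prod_ennreal_divide[symmetric] composite_pdf_nonneg)
    finally show ?thesis .
  qed
  have sets_iid: "sets (iid_sample (P \<theta>) m) = sets (sample_space X m)" if "\<theta> \<in> \<Theta>" for \<theta> m
    unfolding iid_sample_def sample_space_def using family(2)[OF that] by (intro sets_PiM_cong) auto
  have V_measurable: "V k \<in> borel_measurable (iid_sample (P \<theta>) (2 * n))"
    if "\<theta> \<in> \<Theta>" "k \<in> {0, 1}" for \<theta> k
    using statistic[OF that(2)] unfolding V_def
    by (subst measurable_cong_sets[OF sets_iid[OF that(1)] refl])
  have V_le_1: "(\<integral>\<^sup>+ xs. V k xs \<partial>iid_sample (P \<theta>) (2 * n)) \<le> 1"
    if \<theta>0: "\<theta> \<in> \<Theta>0" and k: "k \<in> {0, 1}" for \<theta> k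
  proof -
    have \<theta>: "\<theta> \<in> \<Theta>" using \<theta>0 null by auto
    \<comment> \<open>For \<open>k\<close> in \<open>{0, 1}\<close> the natural-number difference
      \<open>1 - k\<close> is the index of the other half.\<close>
    have disj: "H (1 - k) \<inter> H k = {}" and un: "{1..2 * n} = H (1 - k) \<union> H k"
      using k by (auto simp: H_def)
    show ?thesis
      unfolding iid_sample_def un
    proof (rule nn_integral_cross_fit_le_1[OF family(1)[OF \<theta>] _ _ disj])
      show "V k \<in> borel_measurable (Pi\<^sub>M (H (1 - k) \<union> H k) (\<lambda>_. P \<theta>))"
        using V_measurable[OF \<theta> k] unfolding iid_sample_def un .
      fix ys assume ys: "ys \<in> space (Pi\<^sub>M (H (1 - k)) (\<lambda>_. P \<theta>))"
      \<comment> \<open>Once \<open>ys\<close> is fixed the estimate is a fixed parameter. It lies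
        in \<Theta> but possibly outside \<open>\<Theta>0\<close>, which is all that the composite
        ratio bound asks of its numerator.\<close>
      define t where "t = \<theta>t (1 - k) (half_sample n (1 - k) ys)"
      have "half_sample n (1 - k) ys \<in> space (sample_space X n)"
        using ys by (intro half_space) (auto simp: space_PiM space_P[OF \<theta>])
      then have t: "t \<in> \<Theta>"
        using measurable_space[OF estimator, of "1 - k"] k
        by (auto simp: t_def space_restrict_space)
      let ?\<rho> = "\<lambda>x. ennreal (composite_pdf pm pc a b t x) / ennreal (composite_pdf pm pc a b \<theta> x)"
      note ratio = composite_likelihood_ratio[of \<Theta> P X disc pm pc a b \<theta> t,
          OF family marginal conditional weights \<theta> t]
      have "V k (merge (H (1 - k)) (H k) (ys, zs)) \<le> (\<Prod>j\<in>H k. ?\<rho> (zs j))"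
        if zs: "zs \<in> space (Pi\<^sub>M (H k) (\<lambda>_. P \<theta>))" for zs
      proof -
        let ?xs = "merge (H (1 - k)) (H k) (ys, zs)"
        have zs_eq: "?xs j = zs j" if "j \<in> H k" for j
          using that disj by (auto simp: merge_def)
        \<comment> \<open>The estimate computed from the merged sample sees only \<open>ys\<close>,
          so it does not vary with \<open>zs\<close>.\<close>
        have half_eq: "half_sample n (1 - k) ?xs = half_sample n (1 - k) ys"
          by (auto simp: half_sample_def merge_def H_def fun_eq_iff)
        have in_X: "?xs j \<in> X" if "j \<in> H k" for j
          using zs that by (subst zs_eq) (auto simp: space_PiM space_P[OF \<theta>])
        have "V k ?xs \<le> (\<Prod>j\<in>H k. ?\<rho> (?xs j))"
          using V_le[where xs = ?xs, OF \<theta>0 k in_X] unfolding half_eq t_def by simp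
        also have "\<dots> = (\<Prod>j\<in>H k. ?\<rho> (zs j))"
          by (intro prod.cong refl) (simp only: zs_eq)
        finally show ?thesis .
      qed
      with ratio show "\<exists>\<rho> \<in> borel_measurable (P \<theta>). (\<integral>\<^sup>+ x. \<rho> x \<partial>P \<theta>) \<le> 1 \<and>
          (\<forall>zs \<in> space (Pi\<^sub>M (H k) (\<lambda>_. P \<theta>)).
            V k (merge (H (1 - k)) (H k) (ys, zs)) \<le> (\<Prod>j\<in>H k. \<rho> (zs j)))"
        by (intro bexI[of _ ?\<rho>]) auto
    qed (simp_all add: H_def)
  qed
  have "type_I_error P (2 * n) \<Theta>0 (\<lambda>xs. V 0 xs > ennreal (1 / \<alpha>)) \<le> ennreal \<alpha>"
    unfolding type_I_error_def
    using null \<open>0 < \<alpha>\<close> by (intro SUP_least emeasure_exceeds_inverse_level_le V_measurable V_le_1) auto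
  \<comment> \<open>Both statistics have expectation at most 1, hence so has their average by
    linearity, whatever the dependence between them.\<close>
  moreover have "type_I_error P (2 * n) \<Theta>0 (\<lambda>xs. (V 0 xs + V 1 xs) / 2 > ennreal (1 / \<alpha>)) \<le> ennreal \<alpha>"
    unfolding type_I_error_def
  proof (intro SUP_least emeasure_exceeds_inverse_level_le)
    fix \<theta> assume \<theta>: "\<theta> \<in> \<Theta>0"
    let ?M = "iid_sample (P \<theta>) (2 * n)"
    have [measurable]: "V 0 \<in> borel_measurable ?M" "V 1 \<in> borel_measurable ?M"
      using \<theta> null by (auto intro: V_measurable)
    show "(\<lambda>xs. (V 0 xs + V 1 xs) / 2) \<in> borel_measurable ?M"
      by measurable
    have "(\<integral>\<^sup>+ xs. (V 0 xs + V 1 xs) / 2 \<partial>?M)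
        = ((\<integral>\<^sup>+ xs. V 0 xs \<partial>?M) + (\<integral>\<^sup>+ xs. V 1 xs \<partial>?M)) / 2"
      by (simp add: nn_integral_divide nn_integral_add del: One_nat_def)
    also have "\<dots> \<le> (1 + 1) / 2"
      using \<theta> by (intro divide_right_mono_ennreal add_mono V_le_1) auto
    also have "\<dots> = 1"
      by (simp add: ennreal_divide_self)
    finally show "(\<integral>\<^sup>+ xs. (V 0 xs + V 1 xs) / 2 \<partial>?M) \<le> 1" .
  qed (rule \<open>0 < \<alpha>\<close>)
  ultimately show ?thesis
    by (simp add: V_def swapped_stat_def)
qed

end
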